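(* For any infinite chain $C$, the right diameter of $\operatorname{End}(C)$ is either $2$ or $3$. Furthermore, $\operatorname{End}(C)$ has right diameter $2$ if and only if $C$ has an endpoint $z$ such that $C$ is a quotient of $C\setminus\{z\}$.
   Context: A chain is a totally ordered set. An endpoint of a chain is an element that is its minimum or its maximum. A homomorphism of chains is an order-preserving map ($x\le y$ implies $x\theta\le y\theta$). A chain $D$ is a quotient of a chain $C$ if there is a surjective homomorphism from $C$ onto $D$. $C\setminus\{z\}$ is a chain under the restricted order. $\operatorname{End}(C)$ is the monoid of all order-preserving maps $C\to C$ under composition; maps are written on the right of their arguments and composed left to right, so $x(\alpha\beta)=(x\alpha)\beta$. Right diameter of a monoid $S$. A right congruence on $S$ is an equivalence relation $\rho$ on $S$ such that $(a,b)\in\rho$ implies $(as,bs)\in\rho$ for all $s\in S$. For $U\subseteq S\times S$, the right congruence generated by $U$ is the smallest right congruence containing $U$. For $a,b\in S$, a $U$-sequence from $a$ to $b$ of length $n\in\mathbb{N}_0=\{0,1,2,\dots\}$ is a sequence of equalities $a=u_1s_1,\ v_1s_1=u_2s_2,\ \dots,\ v_ns_n=b$ where, for each $i\in\{1,\dots,n\}$, $s_i\in S$ and $(u_i,v_i)\in U$ or $(v_i,u_i)\in U$; for $n=0$ this is interpreted as $a=b$. The universal right congruence $\omega_S^r=S\times S$ is generated by $U$ if and only if any two elements of $S$ are connected by a $U$-sequence; in that case let $d_U^r(a,b)$ be the least length of a $U$-sequence from $a$ to $b$, and put $D_r(S;U)=\sup\{d_U^r(a,b): a,b\in S\}$. If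 $\omega_S^r$ is finitely generated, the right diameter of $S$ is $D_r(S)=\min\{D_r(S;U): U\text{ is a finite generating set of }\omega_S^r\}$. The assertion that the right diameter equals a given number includes the assertion that $\omega_S^r$ is finitely generated. *)

theory Defs
  imports "HOL-Algebra.Group" "HOL-Library.Extended_Nat"
begin

text \<open>A chain is a linearly ordered type, or a subset of one under the restricted order.\<close>

definition is_endpoint :: "'a::linorder set \<Rightarrow> 'a \<Rightarrow> bool" where
  "is_endpoint C z \<longleftrightarrow> z \<in> C \<and> ((\<forall>x\<in>C. z \<le> x) \<or> (\<forall>x\<in>C. x \<le> z))"

definition is_chain_quotient :: "'b::linorder set \<Rightarrow> 'a::linorder set \<Rightarrow> bool" where
  "is_chain_quotient D C \<longleftrightarrow> (\<exists>\<theta>. mono_on C \<theta> \<and> \<theta> ` C = D)"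

text \<open>Maps act on the right, so the product of \<open>f\<close> and \<open>g\<close> is ``first \<open>f\<close>, then \<open>g\<close>''.
  The chain is the whole type \<open>'a\<close>.\<close>

definition End_chain :: "('a::linorder \<Rightarrow> 'a) monoid" where
  "End_chain = \<lparr>carrier = {f. mono f}, mult = (\<lambda>f g. g \<circ> f), one = id\<rparr>"

lemma monoid_End_chain: "monoid End_chain"
  by (rule monoidI) (auto simp: End_chain_def mono_def)

definition right_congruence :: "('a, 'm) monoid_scheme \<Rightarrow> ('a \<times> 'a) set \<Rightarrow> bool" where
  "right_congruence S \<rho> \<longleftrightarrow>
     equiv (carrier S) \<rho> \<and>
     (\<forall>a b s. (a, b) \<in> \<rho> \<longrightarrow> s \<in> carrier S \<longrightarrow> (a \<otimes>\<^bsub>S\<^esub> s, b \<otimes>\<^bsub>S\<^esub> s) \<in> \<rho>)"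

definition right_congruence_gen ::
    "('a, 'm) monoid_scheme \<Rightarrow> ('a \<times> 'a) set \<Rightarrow> ('a \<times> 'a) set" where
  "right_congruence_gen S U = \<Inter>{\<rho>. right_congruence S \<rho> \<and> U \<subseteq> \<rho>}"

definition generates_universal :: "('a, 'm) monoid_scheme \<Rightarrow> ('a \<times> 'a) set \<Rightarrow> bool" where
  "generates_universal S U \<longleftrightarrow>
     U \<subseteq> carrier S \<times> carrier S \<and> right_congruence_gen S U = carrier S \<times> carrier S"

definition U_sequence ::
    "('a, 'm) monoid_scheme \<Rightarrow> ('a \<times> 'a) set \<Rightarrow> nat \<Rightarrow> 'a \<Rightarrow> 'a \<Rightarrow> bool" where
  "U_sequence S U n a b \<longleftrightarrow>
     (if n = 0 then a = b
      else \<exists>u v s.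
        (\<forall>i\<in>{1..n}. s i \<in> carrier S \<and> ((u i, v i) \<in> U \<or> (v i, u i) \<in> U)) \<and>
        a = u 1 \<otimes>\<^bsub>S\<^esub> s 1 \<and>
        (\<forall>i\<in>{1..<n}. v i \<otimes>\<^bsub>S\<^esub> s i = u (i + 1) \<otimes>\<^bsub>S\<^esub> s (i + 1)) \<and>
        v n \<otimes>\<^bsub>S\<^esub> s n = b)"

text \<open>The next two quantities are meaningful only if \<open>generates_universal S U\<close> holds; then
  the set over which the least element is taken is nonempty for all \<open>a, b \<in> carrier S\<close>.\<close>

definition right_dist :: "('a, 'm) monoid_scheme \<Rightarrow> ('a \<times> 'a) set \<Rightarrow> 'a \<Rightarrow> 'a \<Rightarrow> nat" where
  "right_dist S U a b = (LEAST n. U_sequence S U n a b)"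

definition right_diameter_wrt :: "('a, 'm) monoid_scheme \<Rightarrow> ('a \<times> 'a) set \<Rightarrow> enat" where
  "right_diameter_wrt S U = (SUP (a, b) \<in> carrier S \<times> carrier S. enat (right_dist S U a b))"

definition universal_fin_gen :: "('a, 'm) monoid_scheme \<Rightarrow> bool" where
  "universal_fin_gen S \<longleftrightarrow> (\<exists>U. finite U \<and> generates_universal S U)"

text \<open>A nonempty infimum in \<^typ>\<open>enat\<close> is attained, hence a minimum.\<close>

definition right_diameter :: "('a, 'm) monoid_scheme \<Rightarrow> enat" where
  "right_diameter S = (INF U \<in> {U. finite U \<and> generates_universal S U}. right_diameter_wrt S U)"

definition has_right_diameter :: "('a, 'm) monoid_scheme \<Rightarrow> enat \<Rightarrow> bool" where
  "has_right_diameter S d \<longleftrightarrow> universal_fin_gen S \<and> right_diameter S = d"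

end

theory Submission
  imports Defs
begin

text \<open>
  Write \<open>c\<^sub>x\<close> for the constant map with value \<open>x\<close>. In \<open>End(C)\<close> the right multiples of
  \<open>u\<close> are the maps \<open>s \<circ> u\<close>, so one step of a \<open>U\<close>-sequence leads from \<open>s \<circ> u\<close> to \<open>s \<circ> v\<close>
  for a pair \<open>(u, v)\<close> of \<open>U\<close>, read in either direction, and an endomorphism \<open>s\<close>.

  \<^bold>\<open>Upper bounds.\<close> Fix \<open>z < w\<close>. The pair \<open>(id, c\<^sub>z)\<close> joins every map to a constant in one step, and
  \<open>(c\<^sub>z, c\<^sub>w)\<close> joins any two constants in one step, hence the diameter is at most \<open>3\<close>. If \<open>z\<close> is an
  endpoint and \<open>\<theta>\<close> maps \<open>C - {z}\<close> onto \<open>C\<close>, take a section \<open>w\<close> of \<open>\<theta>\<close>. Every \<open>a\<close> is \<open>s \<circ> w\<close> for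
  some \<open>s\<close> that also fixes \<open>z\<close>, because \<open>z\<close> is an endpoint outside the image of \<open>w\<close>. So the
  single pair \<open>(w, c\<^sub>z)\<close> joins every map to \<open>c\<^sub>z\<close>, and the diameter is at most \<open>2\<close>.

  \<^bold>\<open>Lower bounds.\<close> Start from \<open>id\<close>. A step away from \<open>id\<close> has the form \<open>id = s \<circ> u \<rightarrow> s \<circ> v\<close>
  where \<open>s\<close> is a retraction of \<open>u\<close>. Retractions of one map have at most two values at a given point
  (\<open>finite_retraction_values\<close>): the greatest \<open>p\<close> with \<open>u p\<close> below the point, or the least \<open>p\<close>
  with \<open>u p\<close> above it. Fix a point \<open>x\<close>. For finite \<open>U\<close> the maps one step from
  \<open>id\<close> therefore take only finitely many values at \<open>x\<close>; call the set of these values \<open>F\<close>. Since \<open>C\<close>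
  is infinite, some constant is more than one step from \<open>id\<close>.

  Suppose now that \<open>C\<close> is not a quotient of \<open>C - {z}\<close> for any endpoint \<open>z\<close>. To find a map \<open>b\<close> that is more
  than two steps from \<open>id\<close>, note that the step reaching \<open>b\<close> comes from some \<open>s' \<circ> v'\<close> with
  \<open>b = s' \<circ> u'\<close>. If \<open>u'\<close> has a retraction \<open>t\<close>, then \<open>t (v' x) \<in> F\<close>, and the values of \<open>b\<close> on both
  sides of this point enclose \<open>s' (v' x)\<close>. So it is enough that \<open>b\<close> moves a neighbourhood of
  each point of \<open>F\<close> past every point of \<open>F\<close>, and that \<open>b\<close> is not divisible by those of the finitely many
  \<open>u'\<close> in \<open>U\<close> that have no retraction. Such a \<open>u'\<close> either identifies two points, and then it is enough
  that \<open>b\<close> separates these two points, or some value falls into a gap of \<open>u'\<close>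
  (\<open>no_retraction_cases\<close>), and then it is enough that \<open>b\<close> leaves this gap unfilled. Thus \<open>b\<close> must be injective on a
  finite set, must respect finitely many gaps, and must displace a finite set. Finitely many gaps
  cut \<open>C\<close> into finitely many segments, and on each of them \<open>b\<close> is built separately by squeezing a
  large interval into a small part that avoids \<open>F\<close> (\<open>displacement_of_segment\<close>, \<open>displacement\<close>).
  The hypothesis on endpoints enters through \<open>retraction_image_unbounded\<close>: it makes
  \<open>u'\<close> bound every point on both sides, so that the enclosure also works at an endpoint.
\<close>

section \<open>Distances in a monoid under right translation\<close>

definition translated_pairs ::
    "('a, 'm) monoid_scheme \<Rightarrow> ('a \<times> 'a) set \<Rightarrow> ('a \<times> 'a) set" where
  "translated_pairs S U =
     {(u \<otimes>\<^bsub>S\<^esub> s, v \<otimes>\<^bsub>S\<^esub> s) | u v s. ((u, v) \<in> U \<or> (v, u) \<in> U) \<and> s \<in> carrier S}"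

lemma U_sequence_iff_relpow:
  "U_sequence S U n a b \<longleftrightarrow> (a, b) \<in> translated_pairs S U ^^ n"
proof (cases "n = 0")
  case True
  then show ?thesis by (auto simp: U_sequence_def)
next
  case False
  show ?thesis
  proof
    assume "U_sequence S U n a b"
    then obtain u v s where
      us: "\<forall>i\<in>{1..n}. s i \<in> carrier S \<and> ((u i, v i) \<in> U \<or> (v i, u i) \<in> U)"
      and a: "a = u 1 \<otimes>\<^bsub>S\<^esub> s 1"
      and eq: "\<forall>i\<in>{1..<n}. v i \<otimes>\<^bsub>S\<^esub> s i = u (i + 1) \<otimes>\<^bsub>S\<^esub> s (i + 1)"
      and b: "v n \<otimes>\<^bsub>S\<^esub> s n = b"
      using False unfolding U_sequence_def by auto
    define f where "f i = (if i = 0 then a else v i \<otimes>\<^bsub>S\<^esub> s i)" for i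
    have "(f i, f (Suc i)) \<in> translated_pairs S U" if "i < n" for i
    proof -
      have "f i = u (Suc i) \<otimes>\<^bsub>S\<^esub> s (Suc i)"
        using a eq that by (cases "i = 0") (auto simp: f_def)
      moreover have "f (Suc i) = v (Suc i) \<otimes>\<^bsub>S\<^esub> s (Suc i)" by (simp add: f_def)
      moreover have "s (Suc i) \<in> carrier S \<and>
          ((u (Suc i), v (Suc i)) \<in> U \<or> (v (Suc i), u (Suc i)) \<in> U)"
        using us that by auto
      ultimately show ?thesis unfolding translated_pairs_def by blast
    qed
    moreover have "f 0 = a" "f n = b" using False b by (auto simp: f_def)
    ultimately show "(a, b) \<in> translated_pairs S U ^^ n"
      unfolding relpow_fun_conv by blast
  next
    assume "(a, b) \<in> translated_pairs S U ^^ n"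
    then obtain f where f: "f 0 = a" "f n = b"
      "\<forall>i<n. (f i, f (Suc i)) \<in> translated_pairs S U"
      unfolding relpow_fun_conv by blast
    have "\<forall>i. \<exists>u v s. i < n \<longrightarrow> s \<in> carrier S \<and> ((u, v) \<in> U \<or> (v, u) \<in> U) \<and>
        f i = u \<otimes>\<^bsub>S\<^esub> s \<and> f (Suc i) = v \<otimes>\<^bsub>S\<^esub> s"
      using f(3) unfolding translated_pairs_def by blast
    then obtain u v s where uvs: "\<And>i. i < n \<Longrightarrow> s i \<in> carrier S \<and>
        ((u i, v i) \<in> U \<or> (v i, u i) \<in> U) \<and>
        f i = u i \<otimes>\<^bsub>S\<^esub> s i \<and> f (Suc i) = v i \<otimes>\<^bsub>S\<^esub> s i"
      by metis
    have shift: "v (i - 1) \<otimes>\<^bsub>S\<^esub> s (i - 1) = f i" if "i \<in> {1..n}" for i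
    proof -
      have "i - 1 < n" "Suc (i - 1) = i" using that by auto
      then show ?thesis using uvs[of "i - 1"] by metis
    qed
    have "\<forall>i\<in>{1..n}. s (i - 1) \<in> carrier S \<and>
        ((u (i - 1), v (i - 1)) \<in> U \<or> (v (i - 1), u (i - 1)) \<in> U)"
    proof
      fix i assume "i \<in> {1..n}"
      then have "i - 1 < n" by auto
      then show "s (i - 1) \<in> carrier S \<and>
        ((u (i - 1), v (i - 1)) \<in> U \<or> (v (i - 1), u (i - 1)) \<in> U)"
        using uvs by blast
    qed
    moreover have "a = u (1 - 1) \<otimes>\<^bsub>S\<^esub> s (1 - 1)" using uvs[of 0] f(1) False by simp
    moreover have "\<forall>i\<in>{1..<n}. v (i - 1) \<otimes>\<^bsub>S\<^esub> s (i - 1) = u (i + 1 - 1) \<otimes>\<^bsub>S\<^esub> s (i + 1 - 1)"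
      using shift uvs by simp
    moreover have "v (n - 1) \<otimes>\<^bsub>S\<^esub> s (n - 1) = b" using shift[of n] f(2) False by simp
    ultimately have "\<exists>u v s.
        (\<forall>i\<in>{1..n}. s i \<in> carrier S \<and> ((u i, v i) \<in> U \<or> (v i, u i) \<in> U)) \<and>
        a = u 1 \<otimes>\<^bsub>S\<^esub> s 1 \<and>
        (\<forall>i\<in>{1..<n}. v i \<otimes>\<^bsub>S\<^esub> s i = u (i + 1) \<otimes>\<^bsub>S\<^esub> s (i + 1)) \<and>
        v n \<otimes>\<^bsub>S\<^esub> s n = b"
      by (intro exI[of _ "\<lambda>i. u (i - 1)"] exI[of _ "\<lambda>i. v (i - 1)"]
          exI[of _ "\<lambda>i. s (i - 1)"]) (intro conjI)
    then show "U_sequence S U n a b"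
      using False unfolding U_sequence_def by simp
  qed
qed

lemma sym_translated_pairs: "sym (translated_pairs S U)"
  unfolding sym_def translated_pairs_def by blast

lemma (in monoid) translated_pairs_mult:
  assumes U: "U \<subseteq> carrier G \<times> carrier G"
    and ab: "(a, b) \<in> translated_pairs G U" and t: "t \<in> carrier G"
  shows "(a \<otimes> t, b \<otimes> t) \<in> translated_pairs G U"
proof -
  obtain u v s where *: "a = u \<otimes> s" "b = v \<otimes> s" "(u, v) \<in> U \<or> (v, u) \<in> U" "s \<in> carrier G"
    using ab unfolding translated_pairs_def by blast
  then have "u \<in> carrier G" "v \<in> carrier G" using U by auto
  then have "a \<otimes> t = u \<otimes> (s \<otimes> t)" "b \<otimes> t = v \<otimes> (s \<otimes> t)" "s \<otimes> t \<in> carrier G"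
    using * t by (auto simp: m_assoc)
  then show ?thesis using *(3) unfolding translated_pairs_def by blast
qed

text \<open>
  The pairs \<open>(u s, v s)\<close> are closed under right multiplication, so their equivalence
  closure is already a right congruence. The restriction to the carrier only removes the reflexive
  pairs outside of it.
\<close>
lemma (in monoid) right_congruence_gen_eq_rtrancl:
  assumes U: "U \<subseteq> carrier G \<times> carrier G"
  shows "right_congruence_gen G U =
    (translated_pairs G U)\<^sup>* \<inter> carrier G \<times> carrier G" (is "_ = ?\<rho>")
proof
  have "equiv (carrier G) ?\<rho>"
  proof (rule equivI)
    show "sym ?\<rho>"
      using sym_rtrancl[OF sym_translated_pairs, of G U] unfolding sym_def by blast
    show "trans ?\<rho>" by (rule transI) auto
  qed (auto simp: refl_on_def)
  moreover have "(a \<otimes> t, b \<otimes> t) \<in> ?\<rho>" if ab: "(a, b) \<in> ?\<rho>" and t: "t \<in> carrier G" for a b t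
  proof -
    have "(a, b) \<in> (translated_pairs G U)\<^sup>*" using ab by blast
    then have "(a \<otimes> t, b \<otimes> t) \<in> (translated_pairs G U)\<^sup>*"
      by induction (auto intro: rtrancl_into_rtrancl translated_pairs_mult[OF U _ t])
    then show ?thesis using ab t by auto
  qed
  moreover have "U \<subseteq> ?\<rho>"
  proof (rule subrelI)
    fix u v assume uv: "(u, v) \<in> U"
    then have c: "u \<in> carrier G" "v \<in> carrier G" using U by auto
    have "(u \<otimes> \<one>, v \<otimes> \<one>) \<in> translated_pairs G U"
      using uv one_closed unfolding translated_pairs_def by blast
    then show "(u, v) \<in> ?\<rho>" using c by auto
  qed
  ultimately show "right_congruence_gen G U \<subseteq> ?\<rho>"
    unfolding right_congruence_gen_def right_congruence_def by blast
next
  have "?\<rho> \<subseteq> \<rho>" if \<rho>: "right_congruence G \<rho>" "U \<subseteq> \<rho>" for \<rho>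
  proof (rule subrelI)
    have eq: "equiv (carrier G) \<rho>" using \<rho>(1) unfolding right_congruence_def by blast
    have sub: "translated_pairs G U \<subseteq> \<rho>"
    proof (rule subrelI)
      fix a b assume "(a, b) \<in> translated_pairs G U"
      then obtain u v s where *: "a = u \<otimes> s" "b = v \<otimes> s" "(u, v) \<in> U \<or> (v, u) \<in> U"
          "s \<in> carrier G"
        unfolding translated_pairs_def by blast
      have "(u, v) \<in> \<rho>" using *(3) \<rho>(2) eq by (meson equivE subsetD symD)
      then show "(a, b) \<in> \<rho>" using * \<rho>(1) unfolding right_congruence_def by blast
    qed
    fix a b assume "(a, b) \<in> ?\<rho>"
    then have "(a, b) \<in> (translated_pairs G U)\<^sup>*" and a: "a \<in> carrier G" by auto
    then show "(a, b) \<in> \<rho>"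
    proof induction
      case base
      then show ?case using eq a by (meson equivE refl_onD)
    next
      case (step y z)
      then show ?case using eq sub by (meson equivE subsetD transD)
    qed
  qed
  then show "?\<rho> \<subseteq> right_congruence_gen G U"
    unfolding right_congruence_gen_def by blast
qed

text \<open>
  This is the only interface to the numerical definitions used below: an infimum of extended naturals is
  attained, and a least length is bounded by \<open>k\<close> exactly if some sequence has length at most \<open>k\<close>.
\<close>
lemma (in monoid) right_diameter_le_iff:
  "universal_fin_gen G \<and> right_diameter G \<le> enat k \<longleftrightarrow>
   (\<exists>U. finite U \<and> U \<subseteq> carrier G \<times> carrier G \<and>
     (\<forall>a\<in>carrier G. \<forall>b\<in>carrier G. \<exists>n\<le>k. (a, b) \<in> translated_pairs G U ^^ n))"
    (is "?lhs \<longleftrightarrow> (\<exists>U. ?short U)")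
proof
  assume ?lhs
  then have fin: "universal_fin_gen G" and le: "right_diameter G \<le> enat k" by auto
  let ?X = "right_diameter_wrt G ` {U. finite U \<and> generates_universal G U}"
  have "?X \<noteq> {}" using fin unfolding universal_fin_gen_def by blast
  then have "right_diameter G \<in> ?X"
    unfolding right_diameter_def Inf_enat_def by (auto intro: LeastI)
  then obtain U where U: "finite U" "generates_universal G U"
      "right_diameter_wrt G U \<le> enat k"
    using le by auto
  have Uc: "U \<subseteq> carrier G \<times> carrier G" using U(2) unfolding generates_universal_def by blast
  have "\<exists>n\<le>k. (a, b) \<in> translated_pairs G U ^^ n"
    if ab: "a \<in> carrier G" "b \<in> carrier G" for a b
  proof -
    have "(a, b) \<in> (translated_pairs G U)\<^sup>*"
      using U(2) ab right_congruence_gen_eq_rtrancl[OF Uc]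
      unfolding generates_universal_def by blast
    then have "\<exists>n. U_sequence G U n a b"
      unfolding U_sequence_iff_relpow by (rule rtrancl_imp_relpow)
    then have "U_sequence G U (right_dist G U a b) a b"
      unfolding right_dist_def by (rule LeastI_ex)
    moreover have "enat (right_dist G U a b) \<le> right_diameter_wrt G U"
      unfolding right_diameter_wrt_def
      by (rule SUP_upper2[of "(a, b)"]) (use ab in auto)
    then have "right_dist G U a b \<le> k"
      using U(3) by (metis enat_ord_simps(1) order_trans)
    ultimately show ?thesis unfolding U_sequence_iff_relpow by blast
  qed
  then show "\<exists>U. ?short U" using U(1) Uc by blast
next
  assume "\<exists>U. ?short U"
  then obtain U where U: "finite U" "U \<subseteq> carrier G \<times> carrier G"
    and short: "\<And>a b. a \<in> carrier G \<Longrightarrow> b \<in> carrier G \<Longrightarrow>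
      \<exists>n\<le>k. (a, b) \<in> translated_pairs G U ^^ n"
    by blast
  have "carrier G \<times> carrier G \<subseteq> (translated_pairs G U)\<^sup>*"
    using short relpow_imp_rtrancl by fast
  then have gen: "generates_universal G U"
    using U(2) right_congruence_gen_eq_rtrancl[OF U(2)] unfolding generates_universal_def by blast
  have "right_dist G U a b \<le> k" if "a \<in> carrier G" "b \<in> carrier G" for a b
    unfolding right_dist_def U_sequence_iff_relpow
    using short[OF that] by (meson Least_le order_trans)
  then have "right_diameter_wrt G U \<le> enat k"
    unfolding right_diameter_wrt_def by (auto intro!: SUP_least)
  then have "right_diameter G \<le> enat k"
    unfolding right_diameter_def using U(1) gen by (auto intro: INF_lower2)
  then show ?lhs using U(1) gen unfolding universal_fin_gen_def by blast
qed

section \<open>Translated pairs of chain endomorphisms\<close>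

lemma translated_pairs_End_chain:
  "translated_pairs End_chain U =
     {(s \<circ> u, s \<circ> v) | u v s. ((u, v) \<in> U \<or> (v, u) \<in> U) \<and> mono s}"
  by (simp add: translated_pairs_def End_chain_def)

lemma carrier_End_chain: "carrier End_chain = {f. mono f}"
  by (simp add: End_chain_def)

text \<open>
  With \<open>(id, id)\<close> adjoined every map has a step to itself, so a bound on the length of a sequence can
  be replaced by an exact length, and the degenerate short cases need no separate treatment.
\<close>
definition reflexive_symmetric_pairs :: "(('a \<Rightarrow> 'a) \<times> ('a \<Rightarrow> 'a)) set \<Rightarrow> _" where
  "reflexive_symmetric_pairs U = insert (id, id) (U \<union> U\<inverse>)"

lemma End_chain_short_imp_exact:
  fixes a b :: "'a::linorder \<Rightarrow> 'a"
  assumes "(a, b) \<in> translated_pairs End_chain U ^^ n" "n \<le> k" "mono a"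
  shows "(a, b) \<in> translated_pairs End_chain (reflexive_symmetric_pairs U) ^^ k"
proof -
  let ?T = "translated_pairs End_chain (reflexive_symmetric_pairs U)"
  have "(id, id) \<in> reflexive_symmetric_pairs U" by (simp add: reflexive_symmetric_pairs_def)
  then have loop: "(a, a) \<in> ?T"
    unfolding translated_pairs_End_chain using assms(3) comp_id[of a] by (metis (mono_tags, lifting) CollectI)
  have loops: "(a, a) \<in> ?T ^^ m" for m
    by (induction m) (use loop in auto)
  have sub: "translated_pairs End_chain U \<subseteq> ?T"
    unfolding translated_pairs_End_chain reflexive_symmetric_pairs_def by blast
  have "translated_pairs End_chain U ^^ m \<subseteq> ?T ^^ m" for m
    by (induction m) (auto intro: relcomp_mono[OF _ sub, THEN subsetD])
  then have "(a, b) \<in> ?T ^^ n" using assms(1) by blast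
  with loops[of "k - n"] have "(a, b) \<in> ?T ^^ (k - n) O ?T ^^ n" by blast
  then show ?thesis using assms(2) by (simp flip: relpow_add)
qed

lemma reflexive_symmetric_pairs_simps:
  "finite U \<Longrightarrow> finite (reflexive_symmetric_pairs U)"
  "(v, u) \<in> reflexive_symmetric_pairs U \<longleftrightarrow> (u, v) \<in> reflexive_symmetric_pairs U"
  "U \<subseteq> {f. mono f} \<times> {f. mono f} \<Longrightarrow>
     reflexive_symmetric_pairs U \<subseteq> {f. mono f} \<times> {f :: 'a::linorder \<Rightarrow> 'a. mono f}"
  unfolding reflexive_symmetric_pairs_def by (auto simp: mono_def)

text \<open>
  A map \<open>a\<close> goes to the constant \<open>a z\<close>, then to the constant \<open>b z\<close>, then to \<open>b\<close>. The middle step uses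
  a map with two values whose jump lies between \<open>z\<close> and \<open>w\<close>.
\<close>
lemma End_chain_right_diameter_le_3:
  assumes "infinite (UNIV :: 'a::linorder set)"
  shows "universal_fin_gen (End_chain :: ('a \<Rightarrow> 'a) monoid) \<and>
    right_diameter (End_chain :: ('a \<Rightarrow> 'a) monoid) \<le> enat 3"
proof -
  obtain p q :: 'a where "p \<noteq> q"
    using assms by (metis (full_types) UNIV_I finite.simps finite_subset singletonI subsetI)
  then obtain z w :: 'a where zw: "z < w" using neq_iff by blast
  let ?c = "\<lambda>(x::'a) (_::'a). x"
  let ?U = "{(id, ?c z), (?c z, ?c w)}"
  let ?T = "translated_pairs End_chain ?U"
  have collapse: "(a, ?c (a z)) \<in> ?T" if "mono a" for a
    unfolding translated_pairs_End_chain using that by (force simp: comp_def)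
  have up: "(?c x, ?c y) \<in> ?T" if "x \<le> y" for x y
  proof -
    let ?s = "\<lambda>t. if t < w then x else y"
    have "mono ?s" using that by (auto simp: mono_def)
    moreover have "?c x = ?s \<circ> ?c z" "?c y = ?s \<circ> ?c w" using zw by auto
    ultimately show ?thesis unfolding translated_pairs_End_chain by blast
  qed
  have "(a, b) \<in> ?T ^^ 3" if "mono a" "mono b" for a b
  proof -
    have "(?c (a z), ?c (b z)) \<in> ?T"
      using up[of "a z" "b z"] up[of "b z" "a z"] symD[OF sym_translated_pairs] linear
      by metis
    moreover have "(?c (b z), b) \<in> ?T"
      using collapse[OF that(2)] by (rule symD[OF sym_translated_pairs])
    ultimately show ?thesis using collapse[OF that(1)]
      by (auto simp: numeral_3_eq_3 intro: relcompI)
  qed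
  moreover have "?U \<subseteq> carrier End_chain \<times> carrier End_chain"
    by (auto simp: carrier_End_chain mono_def)
  ultimately show ?thesis
    unfolding monoid.right_diameter_le_iff[OF monoid_End_chain]
    by (intro exI[of _ ?U]) (auto simp: carrier_End_chain)
qed

text \<open>
  Both steps pass through the constant \<open>z\<close>. As \<open>w\<close> avoids \<open>z\<close>, a map \<open>s\<close> with \<open>s \<circ> w = a\<close> may be given
  any value at \<open>z\<close> that keeps it monotone; since \<open>z\<close> is an endpoint, the value \<open>z\<close> suits every \<open>a\<close>.
\<close>
lemma End_chain_right_diameter_le_2:
  fixes z :: "'a::linorder"
  assumes z: "is_endpoint UNIV z" and quot: "is_chain_quotient (UNIV :: 'a set) (UNIV - {z})"
  shows "universal_fin_gen (End_chain :: ('a \<Rightarrow> 'a) monoid) \<and>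
    right_diameter (End_chain :: ('a \<Rightarrow> 'a) monoid) \<le> enat 2"
proof -
  obtain \<theta> where \<theta>: "mono_on (UNIV - {z}) \<theta>" "\<theta> ` (UNIV - {z}) = (UNIV :: 'a set)"
    using quot unfolding is_chain_quotient_def by blast
  define w where "w = inv_into (UNIV - {z}) \<theta>"
  have w: "w y \<noteq> z" "\<theta> (w y) = y" for y
    using inv_into_into[of y \<theta> "UNIV - {z}"] f_inv_into_f[of y \<theta> "UNIV - {z}"] \<theta>(2)
    unfolding w_def by auto
  have "mono w"
  proof (rule monoI, rule ccontr)
    fix x y :: 'a assume "x \<le> y" "\<not> w x \<le> w y"
    then have "w y \<le> w x" "w x \<noteq> w y" by auto
    then have "y \<le> x" using \<theta>(1) w by (metis DiffI UNIV_I mono_onD singletonD)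
    then show False using \<open>x \<le> y\<close> \<open>w x \<noteq> w y\<close> by simp
  qed
  let ?c = "\<lambda>_::'a. z"
  let ?T = "translated_pairs End_chain {(w, ?c)}"
  have collapse: "(a, ?c) \<in> ?T" if "mono a" for a
  proof -
    let ?s = "\<lambda>x. if x = z then z else a (\<theta> x)"
    have "a (\<theta> x) \<le> a (\<theta> y)" if "x \<noteq> z" "y \<noteq> z" "x \<le> y" for x y
      using \<open>mono a\<close> \<theta>(1) that by (auto intro!: monoD[of a] mono_onD[of _ \<theta>])
    then have "mono ?s"
      using z unfolding is_endpoint_def mono_def by (auto dest: antisym)
    moreover have "?s \<circ> w = a" "?s \<circ> ?c = ?c" using w by auto
    ultimately have "(a, ?c) = (?s \<circ> w, ?s \<circ> ?c) \<and> mono ?s" by simp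
    then show ?thesis unfolding translated_pairs_End_chain by blast
  qed
  have "(a, b) \<in> ?T ^^ 2" if "mono a" "mono b" for a b
    using collapse[OF that(1)] symD[OF sym_translated_pairs collapse[OF that(2)]]
    by (auto simp: numeral_2_eq_2 intro: relcompI)
  moreover have "{(w, ?c)} \<subseteq> carrier End_chain \<times> carrier End_chain"
    using \<open>mono w\<close> by (auto simp: carrier_End_chain mono_def)
  ultimately show ?thesis
    unfolding monoid.right_diameter_le_iff[OF monoid_End_chain]
    by (intro exI[of _ "{(w, ?c)}"]) (auto simp: carrier_End_chain)
qed

section \<open>Retractions\<close>

definition retraction_of :: "('a::linorder \<Rightarrow> 'a) \<Rightarrow> ('a \<Rightarrow> 'a) \<Rightarrow> bool" where
  "retraction_of u s \<longleftrightarrow> mono s \<and> s \<circ> u = id"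

lemma retraction_ofD:
  assumes "retraction_of u s"
  shows "s (u p) = p" "u p \<le> c \<Longrightarrow> p \<le> s c" "c \<le> u p \<Longrightarrow> s c \<le> p"
proof -
  show 1: "s (u p) = p" for p
    using assms by (metis comp_apply id_apply retraction_of_def)
  have "mono s" using assms by (simp add: retraction_of_def)
  then show "u p \<le> c \<Longrightarrow> p \<le> s c" "c \<le> u p \<Longrightarrow> s c \<le> p"
    using 1 by (metis monoD)+
qed

text \<open>
  If \<open>u (s c) \<le> c\<close>, then \<open>s c\<close> is the greatest \<open>p\<close> with \<open>u p \<le> c\<close>; otherwise it is the least \<open>p\<close>
  with \<open>c \<le> u p\<close>. Neither description mentions \<open>s\<close>.
\<close>
lemma finite_retraction_values: "finite {s c | s. retraction_of u s}"
proof -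
  let ?M = "{a. u a \<le> c \<and> (\<forall>p. u p \<le> c \<longrightarrow> p \<le> a)}"
  let ?N = "{a. c \<le> u a \<and> (\<forall>p. c \<le> u p \<longrightarrow> a \<le> p)}"
  have sub: "{s c | s. retraction_of u s} \<subseteq> ?M \<union> ?N"
    using retraction_ofD(2,3) linear by blast
  have at_most_one: "finite A" if "\<And>x y. x \<in> A \<Longrightarrow> y \<in> A \<Longrightarrow> x = y"
    for A :: "'a set"
  proof (cases "A = {}")
    case False
    then obtain m where "m \<in> A" by blast
    then have "A \<subseteq> {m}" using that by blast
    then show ?thesis by (rule finite_subset) simp
  qed simp
  have "finite ?M" by (rule at_most_one) (auto intro: antisym)
  moreover have "finite ?N" by (rule at_most_one) (auto intro: antisym)
  ultimately show ?thesis
    using finite_subset[OF sub] by blast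
qed

lemma finite_retraction_orbit:
  assumes "finite U"
  shows "finite {s (v x) | u v s. (u, v) \<in> U \<and> retraction_of u s}"
proof -
  have "{s (v x) | u v s. (u, v) \<in> U \<and> retraction_of u s} =
      (\<Union>(u, v)\<in>U. {s (v x) | s. retraction_of u s})"
    by auto
  then show ?thesis using assms finite_retraction_values by (auto split: prod.split)
qed

text \<open>One step from \<open>id\<close> reaches only finitely many values at a point, but there are infinitely many constants.\<close>
lemma End_chain_not_right_diameter_le_1:
  assumes "infinite (UNIV :: 'a::linorder set)"
  shows "\<not> (universal_fin_gen (End_chain :: ('a \<Rightarrow> 'a) monoid) \<and>
    right_diameter (End_chain :: ('a \<Rightarrow> 'a) monoid) \<le> enat 1)"
proof
  assume "universal_fin_gen (End_chain :: ('a \<Rightarrow> 'a) monoid) \<and>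
    right_diameter (End_chain :: ('a \<Rightarrow> 'a) monoid) \<le> enat 1"
  then obtain U :: "(('a \<Rightarrow> 'a) \<times> ('a \<Rightarrow> 'a)) set" where U: "finite U"
    and short: "\<And>a b. mono a \<Longrightarrow> mono b \<Longrightarrow>
      \<exists>n\<le>1. (a, b) \<in> translated_pairs End_chain U ^^ n"
    unfolding monoid.right_diameter_le_iff[OF monoid_End_chain]
    by (auto simp: carrier_End_chain)
  let ?V = "reflexive_symmetric_pairs U"
  fix x :: 'a
  have "y \<in> {s (v x) | u v s. (u, v) \<in> ?V \<and> retraction_of u s}" for y :: 'a
  proof -
    have "mono (id :: 'a \<Rightarrow> 'a)" "mono (\<lambda>_::'a. y)" by (auto simp: mono_def)
    then have "(id, \<lambda>_. y) \<in> translated_pairs End_chain ?V ^^ 1"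
      using short End_chain_short_imp_exact by blast
    then obtain u v s where *: "(u, v) \<in> ?V" "mono s" "id = s \<circ> u" "(\<lambda>_. y) = s \<circ> v"
      unfolding translated_pairs_End_chain
      by (auto simp: reflexive_symmetric_pairs_simps(2)[where U=U])
    then have "s (v x) = y" "retraction_of u s"
      using fun_cong[OF *(4), of x] by (simp_all add: retraction_of_def)
    then show ?thesis using *(1) by blast
  qed
  then have "(UNIV :: 'a set) \<subseteq> {s (v x) | u v s. (u, v) \<in> ?V \<and> retraction_of u s}"
    by blast
  then show False
    using finite_retraction_orbit[OF reflexive_symmetric_pairs_simps(1)[OF U]] assms
    by (metis (no_types, lifting) finite_subset)
qed

text \<open>
  A gap is given by its lower part \<open>L\<close>. Either part may be empty: \<open>{}\<close> is a gap if
  there is no least element, and \<open>UNIV\<close> is one if there is no greatest element.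
\<close>
definition is_gap :: "'a::linorder set \<Rightarrow> bool" where
  "is_gap L \<longleftrightarrow> (\<forall>x\<in>L. \<forall>y\<le>x. y \<in> L) \<and> (\<forall>x\<in>L. \<exists>y\<in>L. x < y) \<and> (\<forall>x. x \<notin> L \<longrightarrow> (\<exists>y. y \<notin> L \<and> y < x))"

text \<open>
  If \<open>u\<close> is injective and no value \<open>x\<close> cuts the domain in a gap, a retraction can send \<open>x\<close> to the greatest
  \<open>p\<close> with \<open>u p \<le> x\<close>, or, failing that, to the least \<open>p\<close> with \<open>x < u p\<close>.
\<close>
lemma no_retraction_cases:
  assumes u: "mono u" and none: "\<nexists>s. retraction_of u s"
  obtains (collapse) p q where "p < q" "u p = u q"
  | (gap) x where "is_gap {p. u p \<le> x}"
proof (rule ccontr)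
  assume neg: "\<not> thesis"
  have inj: "u p < u q" if "p < q" for p q
    using neg collapse that monoD[OF u, of p q] by (metis less_le)
  let ?max = "\<lambda>x m. u m \<le> x \<and> (\<forall>p. u p \<le> x \<longrightarrow> p \<le> m)"
  let ?min = "\<lambda>x m. x < u m \<and> (\<forall>p. x < u p \<longrightarrow> m \<le> p)"
  have "\<exists>m. ?max x m \<or> ?min x m" for x
  proof (rule ccontr)
    assume "\<nexists>m. ?max x m \<or> ?min x m"
    then have "is_gap {p. u p \<le> x}"
      unfolding is_gap_def using monoD[OF u] by (force simp: not_le)
    then show False using neg gap by blast
  qed
  then obtain m where m: "\<And>x. ?max x (m x) \<or> ?min x (m x)" by metis
  define s where "s x = (if \<exists>m. ?max x m then SOME m. ?max x m else SOME m. ?min x m)" for x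
  have s: "?max x (s x) \<or> (\<nexists>m. ?max x m) \<and> ?min x (s x)" for x
    unfolding s_def using m[of x] someI_ex[of "?max x"] someI_ex[of "?min x"] by auto
  have "mono s"
  proof (rule monoI)
    fix x y :: 'a assume "x \<le> y"
    show "s x \<le> s y"
    proof (cases "?max y (s y)")
      case True
      have "s x \<le> s y" if none: "\<nexists>m. ?max x m" and min: "?min x (s x)"
      proof -
        have "\<exists>p. x < u p \<and> u p \<le> y"
          using none True \<open>x \<le> y\<close> by (meson not_le order_trans)
        then show ?thesis using min True by (meson order_trans)
      qed
      then show ?thesis using s[of x] True \<open>x \<le> y\<close> by (meson order_trans)
    next
      case False
      then have "y < u (s y)" using s[of y] by blast
      then have "x < u (s y)" using \<open>x \<le> y\<close> by simp
      then show ?thesis using s[of x] inj by (meson le_less_trans less_asym' not_le)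
    qed
  qed
  moreover have "s (u p) = p" for p
  proof -
    \<comment> \<open>By injectivity \<open>p\<close> itself is the greatest point that \<open>u\<close> maps below \<open>u p\<close>.\<close>
    have "?max (u p) p" using inj by (metis le_less_linear not_le order.refl)
    then show ?thesis using s[of "u p"] by (meson antisym order.refl)
  qed
  ultimately show False
    using none unfolding retraction_of_def by (metis comp_apply eq_id_iff)
qed

section \<open>Displacing a finite set\<close>

text \<open>
  Nothing lies strictly below a least element, so an endpoint has to serve as its own bound. The
  next two notions allow exactly this exception.
\<close>
definition below_or_least :: "'a::linorder \<Rightarrow> 'a \<Rightarrow> bool" where
  "below_or_least p f \<longleftrightarrow> p < f \<or> p = f \<and> (\<forall>x. f \<le> x)"

definition above_or_greatest :: "'a::linorder \<Rightarrow> 'a \<Rightarrow> bool" where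
  "above_or_greatest q f \<longleftrightarrow> f < q \<or> q = f \<and> (\<forall>x. x \<le> f)"

text \<open>
  The finitely many points of \<open>F\<close> cut the infinite set \<open>D - F\<close> into finitely many pieces; the \<open>d i\<close> are
  taken from an infinite one.
\<close>
lemma infinite_between_finite:
  fixes D F :: "'a::linorder set" and n :: nat
  assumes D: "infinite D" and F: "finite F"
  obtains d where "\<And>i. i \<le> n \<Longrightarrow> d i \<in> D"
    and "\<And>i j. i < j \<Longrightarrow> j \<le> n \<Longrightarrow> d i < d j"
    and "\<And>f. f \<in> F \<Longrightarrow> f < d 0 \<or> d n < f"
proof -
  have "infinite (D - F)" using D F by simp
  moreover have "finite ((\<lambda>x. F \<inter> {..x}) ` (D - F))"
    by (rule finite_subset[of _ "Pow F"]) (use F in auto)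
  ultimately obtain y where "infinite ((\<lambda>x. F \<inter> {..x}) -` {y} \<inter> (D - F))"
    using inf_img_fin_dom' by blast
  then obtain T where T: "finite T" "card T = Suc n"
      "T \<subseteq> (\<lambda>x. F \<inter> {..x}) -` {y} \<inter> (D - F)"
    using infinite_arbitrarily_large by blast
  define d where "d i = sorted_list_of_set T ! i" for i
  have dT: "d i \<in> T" if "i \<le> n" for i
    using nth_mem[of i "sorted_list_of_set T"] that T(1,2) by (simp add: d_def)
  have incr: "d i < d j" if "i < j" "j \<le> n" for i j
    using strict_sorted_list_of_set[of T] that T(1,2)
    by (simp add: d_def sorted_wrt_iff_nth_less)
  have "f < d 0 \<or> d n < f" if f: "f \<in> F" for f
  proof (rule ccontr)
    assume "\<not> ?thesis"
    then have "d 0 \<le> f" "f \<le> d n" by auto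
    then have "f \<in> F \<inter> {..d n}" using f by simp
    also have "F \<inter> {..d n} = F \<inter> {..d 0}" using dT[of 0] dT[of n] T(3) by auto
    finally have "f = d 0" using \<open>d 0 \<le> f\<close> by simp
    then show False using f dT[of 0] T(3) by auto
  qed
  then show thesis using that[of d] dT incr T(3) by blast
qed

text \<open>
  Choose more points \<open>d 0 < d 1 < \<dots>\<close> of \<open>D\<close> than \<open>F\<close> has elements, with no point of \<open>F\<close> among or
  between them, and an interval from \<open>l\<close> to \<open>r\<close> inside \<open>D\<close> that contains all these points and \<open>F \<inter> D\<close> as well. The map
  \<open>\<beta>\<close> sends this interval into the \<open>d i\<close> by counting the points of \<open>F \<inter> D\<close> passed so far, and fixes
  everything else. Every \<open>f\<close> in \<open>F\<close> lies below all \<open>d i\<close>, and then \<open>\<beta> l\<close> exceeds it, or above all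
  of them, and then \<open>\<beta> r\<close> is smaller. The hypotheses \<open>down\<close> and \<open>up\<close> say that \<open>D\<close> has no end points
  except end points of the whole chain.
\<close>
lemma displacement_of_segment:
  fixes D F :: "'a::linorder set"
  assumes inf: "infinite (UNIV :: 'a set)" and F: "finite F" and ne: "D \<noteq> {}"
    and convex: "\<forall>x\<in>D. \<forall>y\<in>D. {x..y} \<subseteq> D"
    and down: "\<forall>e\<in>D. \<exists>p\<in>D. below_or_least p e"
    and up: "\<forall>e\<in>D. \<exists>q\<in>D. above_or_greatest q e"
  obtains \<beta> l r where "l \<in> D" "r \<in> D" "mono_on D \<beta>" "\<beta> ` D \<subseteq> D" "inj_on \<beta> (F \<inter> D)"
    "\<And>x. x < l \<or> r < x \<Longrightarrow> \<beta> x = x"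
    "\<And>e f. e \<in> F \<inter> D \<Longrightarrow> f \<in> F \<Longrightarrow>
       below_or_least l e \<and> f < \<beta> l \<or> above_or_greatest r e \<and> \<beta> r < f"
proof -
  have lower: "\<exists>l\<in>D. \<forall>e\<in>E. below_or_least l e" if E: "finite E" "E \<noteq> {}" "E \<subseteq> D" for E
  proof -
    obtain l where "l \<in> D" "below_or_least l (Min E)"
      using down Min_in[OF E(1,2)] E(3) by blast
    moreover have "below_or_least l e" if "e \<in> E" for e
      using \<open>below_or_least l (Min E)\<close> Min_le[OF \<open>finite E\<close> that]
      unfolding below_or_least_def by (auto simp: le_less)
    ultimately show ?thesis by blast
  qed
  have upper: "\<exists>r\<in>D. \<forall>e\<in>E. above_or_greatest r e" if E: "finite E" "E \<noteq> {}" "E \<subseteq> D" for E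
  proof -
    obtain r where "r \<in> D" "above_or_greatest r (Max E)"
      using up Max_in[OF E(1,2)] E(3) by blast
    moreover have "above_or_greatest r e" if "e \<in> E" for e
      using \<open>above_or_greatest r (Max E)\<close> Max_ge[OF \<open>finite E\<close> that]
      unfolding above_or_greatest_def by (auto simp: le_less)
    ultimately show ?thesis by blast
  qed
  have "infinite D"
  proof
    \<comment> \<open>A finite segment would have to end at the least and the greatest element of the chain.\<close>
    assume "finite D"
    then obtain l r where lr: "l \<in> D" "\<forall>e\<in>D. below_or_least l e"
        "r \<in> D" "\<forall>e\<in>D. above_or_greatest r e"
      using lower[of D] upper[of D] ne by auto
    then have "\<forall>x. l \<le> x" "\<forall>x. x \<le> r"
      unfolding below_or_least_def above_or_greatest_def by (metis less_irrefl)+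
    then have "{l..r} = UNIV" by auto
    then have "D = UNIV" using convex lr by blast
    then show False using \<open>finite D\<close> inf by simp
  qed
  then obtain d where dD: "\<And>i. i \<le> card F \<Longrightarrow> d i \<in> D"
    and d_less: "\<And>i j. i < j \<Longrightarrow> j \<le> card F \<Longrightarrow> d i < d j"
    and dF: "\<And>f. f \<in> F \<Longrightarrow> f < d 0 \<or> d (card F) < f"
    using infinite_between_finite[OF _ F, where n = "card F"] by blast
  have d_le: "d i \<le> d j" if "i \<le> j" "j \<le> card F" for i j
    using d_less that by (cases "i = j") (auto intro: less_imp_le)
  let ?E = "F \<inter> D \<union> d ` {..card F}"
  have E: "finite ?E" "?E \<noteq> {}" "?E \<subseteq> D" using F dD by auto
  obtain l where l: "l \<in> D" "\<And>e. e \<in> ?E \<Longrightarrow> below_or_least l e" using lower[OF E] by blast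
  obtain r where r: "r \<in> D" "\<And>e. e \<in> ?E \<Longrightarrow> above_or_greatest r e" using upper[OF E] by blast
  have lE: "l \<le> e" "e \<le> r" if "e \<in> ?E" for e
    using l(2)[OF that] r(2)[OF that] unfolding below_or_least_def above_or_greatest_def by auto
  define rank where "rank x = card (F \<inter> D \<inter> {..x})" for x
  have rank_le: "rank x \<le> card F" for x
    unfolding rank_def by (rule card_mono[OF F]) auto
  have rank_mono: "rank x \<le> rank y" if "x \<le> y" for x y
    unfolding rank_def by (rule card_mono) (use F that in auto)
  have rank_less: "rank x < rank y" if "x < y" "y \<in> F \<inter> D" for x y
  proof -
    have "y \<in> F \<inter> D \<inter> {..y}" "y \<notin> F \<inter> D \<inter> {..x}" using that by auto
    moreover have "F \<inter> D \<inter> {..x} \<subseteq> F \<inter> D \<inter> {..y}" using that(1) by auto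
    ultimately have "F \<inter> D \<inter> {..x} \<subset> F \<inter> D \<inter> {..y}" by blast
    then show ?thesis unfolding rank_def by (rule psubset_card_mono[rotated]) (use F in simp)
  qed
  define \<beta> where "\<beta> x = (if l \<le> x \<and> x \<le> r then d (rank x) else x)" for x
  have d_between: "l \<le> d (rank x)" "d (rank x) \<le> r" for x
    using lE[of "d (rank x)"] rank_le by auto
  have lr: "l \<le> r" using d_between order_trans by blast
  have d0: "d 0 \<le> d (rank x)" "d (rank x) \<le> d (card F)" for x
    using d_le rank_le by auto
  have "mono_on D \<beta>"
  proof (rule mono_onI)
    fix x y :: 'a assume "x \<le> y"
    then have "d (rank x) \<le> d (rank y)" using d_le rank_mono rank_le by blast
    then show "\<beta> x \<le> \<beta> y"
      using \<open>x \<le> y\<close> d_between[of x] d_between[of y] unfolding \<beta>_def by auto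
  qed
  moreover have "\<beta> ` D \<subseteq> D" using dD rank_le by (auto simp: \<beta>_def)
  moreover have "inj_on \<beta> (F \<inter> D)"
  proof (rule linorder_inj_onI)
    fix x y assume xy: "x < y" "x \<in> F \<inter> D" "y \<in> F \<inter> D"
    then have "d (rank x) < d (rank y)" using d_less rank_less rank_le by blast
    then show "\<beta> x \<noteq> \<beta> y" using lE[of x] lE[of y] xy unfolding \<beta>_def by simp
  qed auto
  moreover have "\<beta> x = x" if "x < l \<or> r < x" for x using that by (auto simp: \<beta>_def)
  moreover have "below_or_least l e \<and> f < \<beta> l \<or> above_or_greatest r e \<and> \<beta> r < f"
    if "e \<in> F \<inter> D" "f \<in> F" for e f
    using dF[OF that(2)] d0[of l] d0[of r] l(2)[of e] r(2)[of e] that(1) lr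
    unfolding \<beta>_def by auto
  ultimately show thesis using that l(1) r(1) by blast
qed

text \<open>
  Two points lie in the same segment if they belong to the same lower parts \<open>L \<in> \<G>\<close>; this set of
  lower parts is the key of a point. A gap provides no end point on either side, so end points of segments can only
  be end points of the chain, and each segment is mapped to itself by \<open>displacement_of_segment\<close>.
  The maps agree with the identity outside of finitely many closed intervals, each within one segment;
  hence the points of \<open>L\<close> above all intervals that lie in \<open>L\<close> are fixed, which keeps the
  gap unfilled from below, and likewise from above.
\<close>
lemma displacement:
  fixes F :: "'a::linorder set" and \<G> :: "'a set set"
  assumes inf: "infinite (UNIV :: 'a set)" and F: "finite F"
    and \<G>: "finite \<G>" "\<And>L. L \<in> \<G> \<Longrightarrow> is_gap L"
  obtains b where "mono b" "inj_on b F"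
    "\<And>L c. L \<in> \<G> \<Longrightarrow> c \<in> L \<Longrightarrow> \<exists>p\<in>L. c < b p"
    "\<And>L c. L \<in> \<G> \<Longrightarrow> c \<notin> L \<Longrightarrow> \<exists>q. q \<notin> L \<and> b q < c"
    "\<And>e f. e \<in> F \<Longrightarrow> f \<in> F \<Longrightarrow>
      (\<exists>p. below_or_least p e \<and> f < b p) \<or> (\<exists>q. above_or_greatest q e \<and> b q < f)"
proof -
  define key where "key x = {L \<in> \<G>. x \<in> L}" for x
  define D where "D K = {x. key x = K}" for K
  have downset: "y \<in> L" if "L \<in> \<G>" "x \<in> L" "y \<le> x" for L x y
    using \<G>(2) that unfolding is_gap_def by blast
  have finite_keys: "finite (range key)"
    by (rule finite_subset[of _ "Pow \<G>"]) (use \<G>(1) in \<open>auto simp: key_def\<close>)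
  define good where "good K \<beta> l r \<longleftrightarrow>
      l \<in> D K \<and> r \<in> D K \<and> mono_on (D K) \<beta> \<and> \<beta> ` D K \<subseteq> D K \<and> inj_on \<beta> (F \<inter> D K) \<and>
      (\<forall>x. x < l \<or> r < x \<longrightarrow> \<beta> x = x) \<and>
      (\<forall>e\<in>F \<inter> D K. \<forall>f\<in>F. below_or_least l e \<and> f < \<beta> l \<or> above_or_greatest r e \<and> \<beta> r < f)"
    for K \<beta> l r
  have "\<exists>t. good K (fst t) (fst (snd t)) (snd (snd t))" if "K \<in> range key" for K
  proof -
    have ne: "D K \<noteq> {}" using that unfolding D_def by blast
    have convex: "\<forall>x\<in>D K. \<forall>y\<in>D K. {x..y} \<subseteq> D K"
    proof (intro ballI subsetI)
      fix x y t assume "x \<in> D K" "y \<in> D K" "t \<in> {x..y}"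
      then have "key x = K" "key y = K" "x \<le> t" "t \<le> y" unfolding D_def by auto
      moreover have "key y \<subseteq> key t" if "t \<le> y" for t y
        unfolding key_def using downset[OF _ _ that] by blast
      ultimately show "t \<in> D K" unfolding D_def by blast
    qed
    have down: "\<forall>e\<in>D K. \<exists>p\<in>D K. below_or_least p e"
    proof
      fix e assume e: "e \<in> D K"
      show "\<exists>p\<in>D K. below_or_least p e"
      proof (cases "\<forall>x. e \<le> x")
        case True
        then show ?thesis using e unfolding below_or_least_def by blast
      next
        case False
        then obtain x where "x < e" by (meson not_le)
        have "\<forall>L. \<exists>y. L \<in> \<G> \<and> e \<notin> L \<longrightarrow> y \<notin> L \<and> y < e"
          using \<G>(2) unfolding is_gap_def by meson
        then obtain y where y: "\<And>L. L \<in> \<G> \<Longrightarrow> e \<notin> L \<Longrightarrow> y L \<notin> L \<and> y L < e" by metis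
        let ?Y = "insert x (y ` {L \<in> \<G>. e \<notin> L})"
        have fin: "finite ?Y" using \<G>(1) by simp
        have "Max ?Y < e" using fin \<open>x < e\<close> y by auto
        moreover have "Max ?Y \<in> L \<longleftrightarrow> e \<in> L" if "L \<in> \<G>" for L
        proof
          assume L: "Max ?Y \<in> L"
          show "e \<in> L"
          proof (rule ccontr)
            assume "e \<notin> L"
            then have "y L \<le> Max ?Y" using fin that by (intro Max_ge) auto
            then show False using y[OF that \<open>e \<notin> L\<close>] downset[OF that L] by blast
          qed
        next
          assume "e \<in> L"
          then show "Max ?Y \<in> L" using downset[OF that] \<open>Max ?Y < e\<close> by simp
        qed
        then have "key (Max ?Y) = key e" unfolding key_def by blast
        ultimately show ?thesis using e unfolding D_def below_or_least_def by auto
      qed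
    qed
    have up: "\<forall>e\<in>D K. \<exists>q\<in>D K. above_or_greatest q e"
    proof
      fix e assume e: "e \<in> D K"
      show "\<exists>q\<in>D K. above_or_greatest q e"
      proof (cases "\<forall>x. x \<le> e")
        case True
        then show ?thesis using e unfolding above_or_greatest_def by blast
      next
        case False
        then obtain x where "e < x" by (meson not_le)
        have "\<forall>L. \<exists>y. L \<in> \<G> \<and> e \<in> L \<longrightarrow> y \<in> L \<and> e < y"
          using \<G>(2) unfolding is_gap_def by meson
        then obtain y where y: "\<And>L. L \<in> \<G> \<Longrightarrow> e \<in> L \<Longrightarrow> y L \<in> L \<and> e < y L" by metis
        let ?Y = "insert x (y ` {L \<in> \<G>. e \<in> L})"
        have fin: "finite ?Y" using \<G>(1) by simp
        have "e < Min ?Y" using fin \<open>e < x\<close> y by auto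
        moreover have "Min ?Y \<in> L \<longleftrightarrow> e \<in> L" if "L \<in> \<G>" for L
        proof
          assume "e \<in> L"
          then have "Min ?Y \<le> y L" using fin that by (intro Min_le) auto
          then show "Min ?Y \<in> L" using y[OF that \<open>e \<in> L\<close>] downset[OF that] by blast
        next
          assume "Min ?Y \<in> L"
          then show "e \<in> L" using downset[OF that] \<open>e < Min ?Y\<close> by simp
        qed
        then have "key (Min ?Y) = key e" unfolding key_def by blast
        ultimately show ?thesis using e unfolding D_def above_or_greatest_def by auto
      qed
    qed
    obtain \<beta> l r where "l \<in> D K" "r \<in> D K" "mono_on (D K) \<beta>" "\<beta> ` D K \<subseteq> D K"
      "inj_on \<beta> (F \<inter> D K)" "\<And>x. x < l \<or> r < x \<Longrightarrow> \<beta> x = x"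
      "\<And>e f. e \<in> F \<inter> D K \<Longrightarrow> f \<in> F \<Longrightarrow>
         below_or_least l e \<and> f < \<beta> l \<or> above_or_greatest r e \<and> \<beta> r < f"
      by (rule displacement_of_segment[OF inf F ne convex down up]) (rule that; assumption)
    then have "good K \<beta> l r" unfolding good_def by blast
    then show ?thesis by (intro exI[of _ "(\<beta>, l, r)"]) simp
  qed
  then obtain T where T: "\<forall>K\<in>range key. good K (fst (T K)) (fst (snd (T K))) (snd (snd (T K)))"
    using bchoice[of "range key" "\<lambda>K t. good K (fst t) (fst (snd t)) (snd (snd t))"] by blast
  define \<beta> l r where "\<beta> K = fst (T K)" and "l K = fst (snd (T K))" and "r K = snd (snd (T K))" for K
  have good: "good K (\<beta> K) (l K) (r K)" if "K \<in> range key" for K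
    using T that unfolding \<beta>_def l_def r_def by (rule bspec)
  have lr: "l K \<in> D K" "r K \<in> D K" and \<beta>_mono: "mono_on (D K) (\<beta> K)"
    and \<beta>_into: "\<beta> K ` D K \<subseteq> D K" and \<beta>_inj: "inj_on (\<beta> K) (F \<inter> D K)"
    if "K \<in> range key" for K
    using good[OF that] unfolding good_def by simp_all
  have \<beta>_id: "\<beta> K x = x" if "K \<in> range key" "x < l K \<or> r K < x" for K x
    using good[OF that(1)] that(2) unfolding good_def by blast
  have \<beta>_move: "below_or_least (l K) e \<and> f < \<beta> K (l K) \<or> above_or_greatest (r K) e \<and> \<beta> K (r K) < f"
    if "K \<in> range key" "e \<in> F \<inter> D K" "f \<in> F" for K e f
    using good[OF that(1)] that(2,3) unfolding good_def by blast
  define b where "b x = \<beta> (key x) x" for x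
  have key_b: "key (b x) = key x" for x
  proof -
    have "x \<in> D (key x)" by (simp add: D_def)
    then have "b x \<in> D (key x)" using \<beta>_into[OF rangeI] unfolding b_def by blast
    then show ?thesis by (simp add: D_def)
  qed
  have key_lr: "key (l (key x)) = key x" "key (r (key x)) = key x" for x
    using lr[OF rangeI, of x] by (simp_all add: D_def)
  have "mono b"
  proof (rule monoI)
    fix x y :: 'a assume xy: "x \<le> y"
    show "b x \<le> b y"
    proof (cases "key x = key y")
      case True
      then show ?thesis using mono_onD[OF \<beta>_mono[OF rangeI, of x], of x y] xy
        by (simp add: b_def D_def)
    next
      case False
      then obtain L where L: "L \<in> \<G>" "x \<in> L" "y \<notin> L"
        using downset xy unfolding key_def by blast
      then have "b x \<in> L" "b y \<notin> L"
        using key_b[of x] key_b[of y] unfolding key_def by blast+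
      then show ?thesis using downset[OF L(1)] linear by blast
    qed
  qed
  moreover have "inj_on b F"
  proof (rule inj_onI)
    fix x y assume xy: "x \<in> F" "y \<in> F" "b x = b y"
    then have "key x = key y" using key_b by metis
    then show "x = y" using inj_onD[OF \<beta>_inj[OF rangeI, of x], of x y] xy
      by (simp add: b_def D_def)
  qed
  moreover have "\<exists>p\<in>L. c < b p" if L: "L \<in> \<G>" and c: "c \<in> L" for L c
  proof -
    let ?R = "insert c (r ` range key \<inter> L)"
    have fin: "finite ?R" using finite_keys by simp
    have "Max ?R \<in> ?R" by (rule Max_in[OF fin]) simp
    then have "Max ?R \<in> L" using c by (elim insertE) simp_all
    then obtain p where p: "p \<in> L" "Max ?R < p" using \<G>(2)[OF L] unfolding is_gap_def by meson
    have "r (key p) \<in> L" using key_lr(2)[of p] p(1) L unfolding key_def by blast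
    then have "r (key p) \<le> Max ?R" "c \<le> Max ?R" using fin by (auto intro: Max_ge)
    then have "r (key p) < p" "c < p" using p(2) by simp_all
    moreover from this have "b p = p" using \<beta>_id[OF rangeI, of p p] by (simp add: b_def)
    ultimately show ?thesis using p(1) by metis
  qed
  moreover have "\<exists>q. q \<notin> L \<and> b q < c" if L: "L \<in> \<G>" and c: "c \<notin> L" for L c
  proof -
    let ?R = "insert c (l ` range key - L)"
    have fin: "finite ?R" using finite_keys by simp
    have "Min ?R \<in> ?R" by (rule Min_in[OF fin]) simp
    then have "Min ?R \<notin> L" using c by (elim insertE) simp_all
    then obtain q where q: "q \<notin> L" "q < Min ?R" using \<G>(2)[OF L] unfolding is_gap_def by meson
    have "l (key q) \<notin> L" using key_lr(1)[of q] q(1) L unfolding key_def by blast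
    then have "Min ?R \<le> l (key q)" "Min ?R \<le> c" using fin by (auto intro: Min_le)
    then have "q < l (key q)" "q < c" using q(2) by simp_all
    moreover from this have "b q = q" using \<beta>_id[OF rangeI, of q q] by (simp add: b_def)
    ultimately show ?thesis using q(1) by metis
  qed
  moreover have "(\<exists>p. below_or_least p e \<and> f < b p) \<or> (\<exists>q. above_or_greatest q e \<and> b q < f)"
    if "e \<in> F" "f \<in> F" for e f
  proof -
    have "e \<in> F \<inter> D (key e)" using that(1) by (simp add: D_def)
    moreover have "b (l (key e)) = \<beta> (key e) (l (key e))" "b (r (key e)) = \<beta> (key e) (r (key e))"
      by (simp_all add: b_def key_lr)
    ultimately show ?thesis using \<beta>_move[OF rangeI, of e e f] that(2) by metis
  qed
  ultimately show thesis by (rule that)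
qed

text \<open>
  For each \<open>u\<close> in \<open>N\<close> without retraction fix a witness from \<open>no_retraction_cases\<close>. If
  \<open>s \<circ> u = b\<close>, a collapsed pair would be collapsed by \<open>b\<close> as well, and in case of a gap the value of \<open>s\<close> at the
  point \<open>x\<close> would lie between the two sides of the gap after applying \<open>b\<close>, which displacement rules out.
\<close>
lemma displacement_divisible_only_by_retractible:
  fixes N :: "('a::linorder \<Rightarrow> 'a) set"
  assumes inf: "infinite (UNIV :: 'a set)" and F: "finite F"
    and N: "finite N" "\<And>u. u \<in> N \<Longrightarrow> mono u"
  obtains b where "mono b"
    "\<And>u s. u \<in> N \<Longrightarrow> mono s \<Longrightarrow> s \<circ> u = b \<Longrightarrow> \<exists>s. retraction_of u s"
    "\<And>e f. e \<in> F \<Longrightarrow> f \<in> F \<Longrightarrow>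
      (\<exists>p. below_or_least p e \<and> f < b p) \<or> (\<exists>q. above_or_greatest q e \<and> b q < f)"
proof -
  let ?N = "{u \<in> N. \<nexists>s. retraction_of u s}"
  \<comment> \<open>A triple \<open>(p, q, x)\<close> records a pair identified by \<open>u\<close> or a point \<open>x\<close> that falls into a gap.\<close>
  define witness where "witness u w \<longleftrightarrow>
      (case w of (p, q, x) \<Rightarrow> p < q \<and> u p = u q \<or> is_gap {t. u t \<le> x})" for u :: "'a \<Rightarrow> 'a" and w
  have "\<exists>w. witness u w" if "u \<in> ?N" for u
  proof -
    have "mono u" "\<nexists>s. retraction_of u s" using that N(2) by auto
    then show ?thesis
    proof (cases rule: no_retraction_cases)
      case (collapse p q)
      then have "witness u (p, q, p)" by (simp add: witness_def)
      then show ?thesis by blast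
    next
      case (gap x)
      then have "witness u (x, x, x)" by (simp add: witness_def)
      then show ?thesis by blast
    qed
  qed
  then obtain w where w: "\<forall>u\<in>?N. witness u (w u)"
    using bchoice[of ?N witness] by blast
  define p q x where "p u = fst (w u)" and "q u = fst (snd (w u))" and "x u = snd (snd (w u))" for u
  have wit: "p u < q u \<and> u (p u) = u (q u) \<or> is_gap {t. u t \<le> x u}" if "u \<in> ?N" for u
    using w that unfolding witness_def p_def q_def x_def by (auto simp: case_prod_beta)
  let ?G = "(\<lambda>u. {t. u t \<le> x u}) ` {u \<in> ?N. is_gap {t. u t \<le> x u}}"
  obtain b where b: "mono b" "inj_on b (F \<union> p ` N \<union> q ` N)"
    and gap_lo: "\<And>L c. L \<in> ?G \<Longrightarrow> c \<in> L \<Longrightarrow> \<exists>p\<in>L. c < b p"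
    and gap_hi: "\<And>L c. L \<in> ?G \<Longrightarrow> c \<notin> L \<Longrightarrow> \<exists>q. q \<notin> L \<and> b q < c"
    and move: "\<And>e f. e \<in> F \<union> p ` N \<union> q ` N \<Longrightarrow> f \<in> F \<union> p ` N \<union> q ` N \<Longrightarrow>
      (\<exists>p. below_or_least p e \<and> f < b p) \<or> (\<exists>q. above_or_greatest q e \<and> b q < f)"
  proof (rule displacement[OF inf, of "F \<union> p ` N \<union> q ` N" ?G])
    show "finite (F \<union> p ` N \<union> q ` N)" "finite ?G" using F N(1) by simp_all
    show "is_gap L" if "L \<in> ?G" for L using that by auto
  qed (rule that; assumption)
  have "\<exists>s. retraction_of u s" if u: "u \<in> N" and s: "mono s" "s \<circ> u = b" for u s
  proof (rule ccontr)
    assume "\<nexists>s. retraction_of u s"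
    then have uN: "u \<in> ?N" using u by blast
    have su: "s (u t) = b t" for t using s(2) by auto
    from wit[OF uN] show False
    proof
      assume pq: "p u < q u \<and> u (p u) = u (q u)"
      then have "b (p u) = b (q u)" using su by metis
      then have "p u = q u" by (rule inj_onD[OF b(2)]) (use u in simp_all)
      then show False using pq by simp
    next
      let ?L = "{t. u t \<le> x u}"
      assume "is_gap ?L"
      then have L: "?L \<in> ?G" using uN by blast
      have lo: "b t \<le> s (x u)" if "t \<in> ?L" for t
        using monoD[OF s(1), of "u t" "x u"] that su by simp
      have hi: "s (x u) \<le> b t" if "t \<notin> ?L" for t
        using monoD[OF s(1), of "x u" "u t"] that su by simp
      show False
        using gap_lo[OF L, of "s (x u)"] gap_hi[OF L, of "s (x u)"] lo hi by (meson not_le)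
    qed
  qed
  then show thesis using move by (rule that[OF b(1)]) simp_all
qed

section \<open>Distance two\<close>

text \<open>
  If every value of \<open>u\<close> were above \<open>c\<close>, then \<open>s c\<close> would be a least element outside the image of \<open>u\<close>,
  and \<open>s\<close> would still be onto after removing it, contrary to \<open>rigid\<close>. The other bound is dual.
\<close>
lemma retraction_image_unbounded:
  fixes u :: "'a::linorder \<Rightarrow> 'a"
  assumes rigid: "\<nexists>z::'a. is_endpoint UNIV z \<and> is_chain_quotient (UNIV :: 'a set) (UNIV - {z})"
    and s: "retraction_of u s"
  shows "\<exists>p. u p \<le> c" "\<exists>q. c \<le> u q"
proof -
  have quotient: "is_chain_quotient (UNIV :: 'a set) (UNIV - {z})" if "z \<notin> range u" for z
  proof -
    have "mono_on (UNIV - {z}) s"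
      using s by (auto simp: retraction_of_def intro: mono_onI monoD)
    moreover have "y \<in> s ` (UNIV - {z})" for y
      using that retraction_ofD(1)[OF s, of y] by (metis DiffI UNIV_I imageI rangeI singletonD)
    then have "s ` (UNIV - {z}) = UNIV" by blast
    ultimately show ?thesis unfolding is_chain_quotient_def by blast
  qed
  show "\<exists>p. u p \<le> c"
  proof (rule ccontr)
    assume "\<nexists>p. u p \<le> c"
    then have c: "c < u p" for p by (meson not_le)
    then have least: "s c \<le> p" for p using retraction_ofD(3)[OF s] by (meson less_imp_le)
    then have "s c \<notin> range u" using c by (metis not_le rangeE)
    then show False using rigid quotient least unfolding is_endpoint_def by blast
  qed
  show "\<exists>q. c \<le> u q"
  proof (rule ccontr)
    assume "\<nexists>q. c \<le> u q"
    then have c: "u p < c" for p by (meson not_le)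
    then have greatest: "p \<le> s c" for p using retraction_ofD(2)[OF s] by (meson less_imp_le)
    then have "s c \<notin> range u" using c by (metis not_le rangeE)
    then show False using rigid quotient greatest unfolding is_endpoint_def by blast
  qed
qed

text \<open>
  Suppose \<open>id = s \<circ> u\<close>, \<open>c = s \<circ> v = s' \<circ> v'\<close> and \<open>b = s' \<circ> u'\<close>. Both \<open>c x\<close> and \<open>t (v' x)\<close>, for a
  retraction \<open>t\<close> of \<open>u'\<close>, belong to the finite set \<open>?F\<close>. Points \<open>p\<close> below \<open>t (v' x)\<close> satisfy
  \<open>u' p \<le> v' x\<close> and hence \<open>b p \<le> c x\<close>, and dually for points above it. This contradicts that \<open>b\<close> displaces \<open>?F\<close>.
\<close>
lemma End_chain_not_right_diameter_le_2:
  assumes inf: "infinite (UNIV :: 'a::linorder set)"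
    and rigid: "\<nexists>z::'a. is_endpoint UNIV z \<and> is_chain_quotient (UNIV :: 'a set) (UNIV - {z})"
  shows "\<not> (universal_fin_gen (End_chain :: ('a \<Rightarrow> 'a) monoid) \<and>
    right_diameter (End_chain :: ('a \<Rightarrow> 'a) monoid) \<le> enat 2)"
proof
  assume "universal_fin_gen (End_chain :: ('a \<Rightarrow> 'a) monoid) \<and>
    right_diameter (End_chain :: ('a \<Rightarrow> 'a) monoid) \<le> enat 2"
  then obtain U :: "(('a \<Rightarrow> 'a) \<times> ('a \<Rightarrow> 'a)) set" where U: "finite U"
      "U \<subseteq> {f. mono f} \<times> {f. mono f}"
    and short: "\<And>a b. mono a \<Longrightarrow> mono b \<Longrightarrow>
      \<exists>n\<le>2. (a, b) \<in> translated_pairs End_chain U ^^ n"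
    unfolding monoid.right_diameter_le_iff[OF monoid_End_chain]
    by (auto simp: carrier_End_chain)
  let ?V = "reflexive_symmetric_pairs U"
  fix x :: 'a
  let ?F = "{s (v x) | u v s. (u, v) \<in> ?V \<and> retraction_of u s}"
  have V: "finite ?V" "?V \<subseteq> {f. mono f} \<times> {f. mono f}"
    using reflexive_symmetric_pairs_simps U by blast+
  have N: "finite (fst ` ?V)" "\<And>u. u \<in> fst ` ?V \<Longrightarrow> mono u" using V by auto
  obtain b where b: "mono b"
    and b_retr: "\<And>u s. u \<in> fst ` ?V \<Longrightarrow> mono s \<Longrightarrow> s \<circ> u = b \<Longrightarrow> \<exists>s. retraction_of u s"
    and b_move: "\<And>e f. e \<in> ?F \<Longrightarrow> f \<in> ?F \<Longrightarrow>
      (\<exists>p. below_or_least p e \<and> f < b p) \<or> (\<exists>q. above_or_greatest q e \<and> b q < f)"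
    using displacement_divisible_only_by_retractible
      [OF inf finite_retraction_orbit[OF V(1)] N] by blast
  have "(id, b) \<in> translated_pairs End_chain ?V ^^ 2"
    using short[of id b] b End_chain_short_imp_exact[of id b] by (auto simp: mono_def)
  then obtain c where c: "(id, c) \<in> translated_pairs End_chain ?V"
      "(c, b) \<in> translated_pairs End_chain ?V"
    by (auto simp: numeral_2_eq_2)
  obtain u v s where 1: "(u, v) \<in> ?V" "mono s" "id = s \<circ> u" "c = s \<circ> v"
    using c(1) unfolding translated_pairs_End_chain
    by (auto simp: reflexive_symmetric_pairs_simps(2)[where U=U])
  obtain u' v' s' where 2: "(u', v') \<in> ?V" "mono s'" "b = s' \<circ> u'" "c = s' \<circ> v'"
    using symD[OF sym_translated_pairs c(2)] unfolding translated_pairs_End_chain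
    by (auto simp: reflexive_symmetric_pairs_simps(2)[where U=U])
  have "retraction_of u s" using 1(2,3) by (simp add: retraction_of_def)
  then have cF: "c x \<in> ?F" using 1(1,4) by auto
  have "u' \<in> fst ` ?V" using 2(1) by force
  then obtain t where t: "retraction_of u' t" using b_retr 2(2,3) by blast
  then have tF: "t (v' x) \<in> ?F" using 2(1) by blast
  have "b p \<le> c x" if p: "below_or_least p (t (v' x))" for p
  proof -
    have "u' p \<le> v' x"
    proof (cases "p < t (v' x)")
      case True
      then show ?thesis using retraction_ofD(3)[OF t, of "v' x" p] by (meson linear not_le)
    next
      case False
      then have least: "\<forall>y. p \<le> y" using p unfolding below_or_least_def by blast
      obtain p' where "u' p' \<le> v' x" using retraction_image_unbounded(1)[OF rigid t] by blast
      moreover have "u' p \<le> u' p'" using least N(2)[OF \<open>u' \<in> fst ` ?V\<close>] by (simp add: monoD)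
      ultimately show ?thesis by simp
    qed
    then show ?thesis using monoD[OF 2(2)] 2(3,4) by simp
  qed
  moreover have "c x \<le> b q" if q: "above_or_greatest q (t (v' x))" for q
  proof -
    have "v' x \<le> u' q"
    proof (cases "t (v' x) < q")
      case True
      then show ?thesis using retraction_ofD(2)[OF t, of q "v' x"] by (meson linear not_le)
    next
      case False
      then have greatest: "\<forall>y. y \<le> q" using q unfolding above_or_greatest_def by blast
      obtain q' where "v' x \<le> u' q'" using retraction_image_unbounded(2)[OF rigid t] by blast
      moreover have "u' q' \<le> u' q" using greatest N(2)[OF \<open>u' \<in> fst ` ?V\<close>] by (simp add: monoD)
      ultimately show ?thesis by simp
    qed
    then show ?thesis using monoD[OF 2(2)] 2(3,4) by simp
  qed
  ultimately show False using b_move[OF tF cF] by (meson not_le)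
qed

theorem theorem2:
  assumes "infinite (UNIV :: 'a::linorder set)"
  shows "(has_right_diameter (End_chain :: ('a \<Rightarrow> 'a) monoid) 2 \<or>
          has_right_diameter (End_chain :: ('a \<Rightarrow> 'a) monoid) 3) \<and>
         (has_right_diameter (End_chain :: ('a \<Rightarrow> 'a) monoid) 2 \<longleftrightarrow>
          (\<exists>z::'a. is_endpoint UNIV z \<and> is_chain_quotient (UNIV :: 'a set) (UNIV - {z})))"
    (is "_ \<and> (_ \<longleftrightarrow> ?quotient)")
proof -
  let ?d = "right_diameter (End_chain :: ('a \<Rightarrow> 'a) monoid)"
  have fin: "universal_fin_gen (End_chain :: ('a \<Rightarrow> 'a) monoid)" and "?d \<le> enat 3"
    using End_chain_right_diameter_le_3[OF assms] by auto
  then obtain k where k: "?d = enat k" "k \<le> 3" by (cases ?d) auto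
  moreover have "\<not> k \<le> 1" using End_chain_not_right_diameter_le_1[OF assms] fin k by auto
  moreover have "k \<le> 2 \<longleftrightarrow> ?quotient"
    using End_chain_right_diameter_le_2 End_chain_not_right_diameter_le_2[OF assms] fin k by force
  ultimately show ?thesis
    using fin unfolding has_right_diameter_def by (auto simp: numeral_eq_enat)
qed

end
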